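(* Suppose that $f$ and $\mathcal{L}^{\mu,\mu}[f]$ belong to $L^{1}\cap L^{2}(\mathbb{R}^2, \mathbb{H}(\mu))$. Then $$\int_{\mathbb{R}^{2}}|f(\tau_{1},\tau_{2})|^{2}\,d\tau_{1}d\tau_{2}=\int_{\mathbb{R}^{2}}|\mathcal{L}^{\mu,\mu}[f](u,v)|^{2}\,du\,dv.$$
   Context: $\mathbb H$ is the quaternion algebra with real basis $1,\mu,\nu,\eta$, where $\mu^2=\nu^2=\eta^2=\mu\nu\eta=-1$, $\mu\nu=-\nu\mu=\eta$. $\mathbb H(\mu)=\{q_r+\mu q_\mu:q_r,q_\mu\in\mathbb R\}$. $L^p(\mathbb R^2,\mathbb H(\mu))$ is the space of $f:\mathbb R^2\to\mathbb H(\mu)$ with $\|f\|_p=(\int_{\mathbb R^2}|f|^p\,dx\,dy)^{1/p}<\infty$. $A_i=\begin{pmatrix}a_i&b_i\\c_i&d_i\end{pmatrix}$, $i=1,2$, are real matrices with $a_id_i-b_ic_i=1$ and $b_i\neq0$. With $$K_{A}^{\mu}(x,u)=\frac{1}{\sqrt{2\pi b\mu}}\,e^{\mu(\frac{a}{2b}x^2-\frac1b xu+\frac{d}{2b}u^2)}\quad\text{for }A=\begin{pmatrix}a&b\\c&d\end{pmatrix}$$ (principal square root in $\mathbb H(\mu)\cong\mathbb C$), the quaternion linear canonical transform of an integrable $f$ is $\mathcal L^{\mu,\mu}[f](u,v)=\int_{\mathbb R^2}K^{\mu}_{A_1}(x,u)f(x,y)K^{\mu}_{A_2}(y,v)\,dx\,dy$.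 *)

theory Defs
  imports "HOL-Analysis.Analysis"
begin

section \<open>The quaternion algebra\<close>

codatatype quat = Quat (q_re: real) (q_mu: real) (q_nu: real) (q_eta: real)

lemma quat_eq_iff:
  "p = q \<longleftrightarrow> q_re p = q_re q \<and> q_mu p = q_mu q \<and> q_nu p = q_nu q \<and> q_eta p = q_eta q"
  by (auto intro: quat.expand)

instantiation quat :: ab_group_add
begin

primcorec zero_quat
  where
    "q_re 0 = 0"
  | "q_mu 0 = 0"
  | "q_nu 0 = 0"
  | "q_eta 0 = 0"

primcorec plus_quat
  where
    "q_re (p + q) = q_re p + q_re q"
  | "q_mu (p + q) = q_mu p + q_mu q"
  | "q_nu (p + q) = q_nu p + q_nu q"
  | "q_eta (p + q) = q_eta p + q_eta q"

primcorec uminus_quat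
  where
    "q_re (- q) = - q_re q"
  | "q_mu (- q) = - q_mu q"
  | "q_nu (- q) = - q_nu q"
  | "q_eta (- q) = - q_eta q"

primcorec minus_quat
  where
    "q_re (p - q) = q_re p - q_re q"
  | "q_mu (p - q) = q_mu p - q_mu q"
  | "q_nu (p - q) = q_nu p - q_nu q"
  | "q_eta (p - q) = q_eta p - q_eta q"

instance
  by standard (simp_all add: quat_eq_iff)

end

instantiation quat :: real_algebra_1
begin

primcorec one_quat
  where
    "q_re 1 = 1"
  | "q_mu 1 = 0"
  | "q_nu 1 = 0"
  | "q_eta 1 = 0"

primcorec times_quat
  where
    "q_re (p * q) = q_re p * q_re q - q_mu p * q_mu q - q_nu p * q_nu q - q_eta p * q_eta q"
  | "q_mu (p * q) = q_re p * q_mu q + q_mu p * q_re q + q_nu p * q_eta q - q_eta p * q_nu q"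
  | "q_nu (p * q) = q_re p * q_nu q - q_mu p * q_eta q + q_nu p * q_re q + q_eta p * q_mu q"
  | "q_eta (p * q) = q_re p * q_eta q + q_mu p * q_nu q - q_nu p * q_mu q + q_eta p * q_re q"

primcorec scaleR_quat
  where
    "q_re (scaleR r q) = r * q_re q"
  | "q_mu (scaleR r q) = r * q_mu q"
  | "q_nu (scaleR r q) = r * q_nu q"
  | "q_eta (scaleR r q) = r * q_eta q"

instance
  by standard (simp_all add: quat_eq_iff algebra_simps)

end

definition mu :: quat where "mu = Quat 0 1 0 0"
definition nu :: quat where "nu = Quat 0 0 1 0"
definition eta :: quat where "eta = Quat 0 0 0 1"

lemma quat_basis:
  "q = of_real (q_re q) + mu * of_real (q_mu q) + nu * of_real (q_nu q) + eta * of_real (q_eta q)"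
  by (simp add: quat_eq_iff of_real_def mu_def nu_def eta_def)

lemma quat_relations:
  "mu * mu = -1" "nu * nu = -1" "eta * eta = -1" "mu * nu * eta = -1"
  "mu * nu = eta" "nu * mu = - eta"
  by (simp_all add: quat_eq_iff mu_def nu_def eta_def)

instantiation quat :: real_inner
begin

definition "inner p q = q_re p * q_re q + q_mu p * q_mu q + q_nu p * q_nu q + q_eta p * q_eta q"

definition "norm q = sqrt ((q_re q)\<^sup>2 + (q_mu q)\<^sup>2 + (q_nu q)\<^sup>2 + (q_eta q)\<^sup>2)"

definition sgn_quat_def: "sgn q = q /\<^sub>R norm q" for q :: quat

definition dist_quat_def: "dist p q = norm (p - q)" for p q :: quat

definition uniformity_quat_def [code del]:
  "(uniformity :: (quat \<times> quat) filter) = (INF e\<in>{0 <..}. principal {(x, y). dist x y < e})"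

definition open_quat_def [code del]:
  "open (U :: quat set) \<longleftrightarrow> (\<forall>x\<in>U. eventually (\<lambda>(x', y). x' = x \<longrightarrow> y \<in> U) uniformity)"

instance
proof
  fix x y z :: quat and r :: real
  show "inner x y = inner y x" "inner (x + y) z = inner x z + inner y z"
    "inner (scaleR r x) y = r * inner x y" "0 \<le> inner x x"
    by (simp_all add: inner_quat_def algebra_simps)
  show "inner x x = 0 \<longleftrightarrow> x = 0"
    by (simp add: inner_quat_def quat_eq_iff add_nonneg_eq_0_iff)
  show "norm x = sqrt (inner x x)"
    by (simp add: inner_quat_def norm_quat_def power2_eq_square)
qed (rule sgn_quat_def dist_quat_def open_quat_def uniformity_quat_def)+

end

instantiation quat :: euclidean_space
begin

definition Basis_quat_def: "Basis = {1, mu, nu, eta}"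

instance
proof
  fix u v x :: quat
  show "inner u v = (if u = v then 1 else 0)" if "u \<in> Basis" "v \<in> Basis"
    using that unfolding Basis_quat_def
    by (elim insertE emptyE) (simp_all add: inner_quat_def quat_eq_iff mu_def nu_def eta_def)
  show "(\<forall>u\<in>Basis. inner x u = 0) \<longleftrightarrow> x = 0"
    unfolding Basis_quat_def quat_eq_iff [of x 0]
    by (simp add: inner_quat_def mu_def nu_def eta_def)
qed (simp_all add: Basis_quat_def)

end

instance quat :: real_normed_algebra_1
proof
  have mult: "norm (x * y) = norm x * norm y" for x y :: quat
    unfolding norm_quat_def real_sqrt_mult [symmetric]
    by (rule arg_cong [where f = sqrt]) (simp add: power2_eq_square algebra_simps)
  show "norm (x * y) \<le> norm x * norm y" for x y :: quat
    by (simp add: mult)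
  show "norm (1 :: quat) = 1"
    by (simp add: norm_quat_def)
qed


section \<open>The subfield spanned by 1 and mu, and its Lebesgue spaces\<close>

definition H_mu :: "quat set"
  where "H_mu = {of_real r + mu * of_real s | r s. True}"

text \<open>The isomorphism from the complex numbers onto \<^term>\<open>H_mu\<close> sending \<^term>\<open>\<i>\<close> to \<^term>\<open>mu\<close>;
  principal square roots and exponentials in \<^term>\<open>H_mu\<close> are transported along it.\<close>

definition of_complex :: "complex \<Rightarrow> quat"
  where "of_complex z = of_real (Re z) + mu * of_real (Im z)"

lemma of_complex_i: "of_complex \<i> = mu"
  by (simp add: of_complex_def)

lemma of_complex_1: "of_complex 1 = 1"
  by (simp add: of_complex_def)

lemma of_complex_add: "of_complex (w + z) = of_complex w + of_complex z"
  by (simp add: of_complex_def quat_eq_iff mu_def of_real_def)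

lemma of_complex_mult: "of_complex (w * z) = of_complex w * of_complex z"
  by (simp add: of_complex_def quat_eq_iff mu_def of_real_def)

lemma norm_of_complex: "norm (of_complex z) = cmod z"
  by (simp add: of_complex_def norm_quat_def cmod_def mu_def of_real_def)

lemma bij_betw_of_complex: "bij_betw of_complex UNIV H_mu"
  unfolding bij_betw_def
proof
  show "inj of_complex"
    by (rule injI) (simp add: of_complex_def quat_eq_iff complex_eq_iff mu_def of_real_def)
  show "range of_complex = H_mu"
    unfolding H_mu_def of_complex_def image_def
    by (auto intro: exI [of _ "Complex _ _"])
qed

text \<open>Elements of \<open>Lp_H_mu p\<close> are actual functions, not classes modulo null sets.\<close>

definition Lp_H_mu :: "real \<Rightarrow> (real \<times> real \<Rightarrow> quat) set"
  where "Lp_H_mu p = {f \<in> borel_measurable lebesgue.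
     (\<forall>z. f z \<in> H_mu) \<and> integrable lebesgue (\<lambda>z. norm (f z) powr p)}"


section \<open>The quaternion linear canonical transform\<close>

text \<open>The row-column entries of \<open>A\<close> are \<open>a = A $ 1 $ 1\<close>, \<open>b = A $ 1 $ 2\<close>, \<open>d = A $ 2 $ 2\<close>.\<close>

definition lct_kernel :: "real ^ 2 ^ 2 \<Rightarrow> real \<Rightarrow> real \<Rightarrow> quat"
  where "lct_kernel A x u =
    (let a = A $ 1 $ 1; b = A $ 1 $ 2; d = A $ 2 $ 2 in
      of_complex (1 / csqrt (of_real (2 * pi * b) * \<i>) *
        exp (\<i> * of_real (a / (2 * b) * x\<^sup>2 - 1 / b * x * u + d / (2 * b) * u\<^sup>2))))"

definition qlct :: "real ^ 2 ^ 2 \<Rightarrow> real ^ 2 ^ 2 \<Rightarrow> (real \<times> real \<Rightarrow> quat) \<Rightarrow> real \<times> real \<Rightarrow> quat"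
  where "qlct A1 A2 f = (\<lambda>(u, v).
    LINT (x, y)|lebesgue. lct_kernel A1 x u * f (x, y) * lct_kernel A2 y v)"

end

theory Submission
  imports Defs "HOL-Probability.Characteristic_Functions"
begin

text \<open>On \<^term>\<open>H_mu\<close>, a copy of the complex numbers, everything commutes. Each kernel splits into a
  constant of modulus \<open>1 / sqrt (2 * pi * \<bar>b\<bar>)\<close>, a chirp in the output variable, a chirp in the input
  variable and a plane wave, so up to unimodular factors the transform of \<open>f\<close> at \<open>(u, v)\<close> is the
  planar Fourier transform of a chirped \<open>f\<close> at \<open>(u / b1, v / b2)\<close>, and the claim becomes Plancherel's
  theorem after rescaling. As the Fourier transform is integrable too, Plancherel's theorem follows
  from Fubini and the almost-everywhere inversion formula. The latter is obtained by integrating the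
  Gaussian-regularised inverse transform over a box: the regularisation turns into convolution of the
  box indicator with a Gaussian approximate identity, which converges boundedly off the frontier.\<close>

section \<open>Measurability, and functions with vanishing box integrals\<close>

lemma borel_measurable_cis [measurable]: "cis \<in> borel_measurable borel"
  by (intro borel_measurable_continuous_onI continuous_intros)

lemma borel_measurable_cnj [measurable]: "cnj \<in> borel_measurable borel"
  by (intro borel_measurable_continuous_onI continuous_intros)

lemma integrable_indicator_box:
  "integrable lborel (indicator (box a b) :: 'a::euclidean_space \<Rightarrow> real)"
  using emeasure_lborel_box_finite[of a b] by (intro integrable_real_indicator) auto

lemma Int_stable_box: "Int_stable (range (\<lambda>(a, b). box a b :: 'a::euclidean_space set))"
  unfolding Int_stable_def by (auto simp: box_Int_box)

text \<open>Boxes are stable under intersection and generate the Borel sets, and the sets over which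
  \<open>f\<close> integrates to 0 form a Dynkin system. Hence every Borel set is among them, which
  forces \<open>f\<close> to vanish almost everywhere.\<close>

lemma AE_eq_0_if_box_integrals_eq_0:
  fixes f :: "'a::euclidean_space \<Rightarrow> 'b::{banach, second_countable_topology}"
  assumes f: "integrable lborel f"
    and box: "\<And>a b. (LINT x:box a b|lborel. f x) = 0"
  shows "AE x in lborel. f x = 0"
proof (rule sigma_finite_measure.density_zero[OF sigma_finite_lborel f])
  have sets_eq: "sets borel = sigma_sets UNIV (range (\<lambda>(a, b). box a b :: 'a set))"
    by (subst borel_eq_box) (simp add: sets_measure_of)
  have subset_Pow: "range (\<lambda>(a, b). box a b :: 'a set) \<subseteq> Pow UNIV"
    by simp
  have si: "set_integrable lborel A f" if "A \<in> sets borel" for A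
    using f that unfolding set_integrable_def by (intro integrable_mult_indicator) auto
  \<comment> \<open>The complement case of the induction needs the integral over the whole space,
    which is the limit of the integrals over growing centred boxes.\<close>
  have total: "(LINT x|lborel. f x) = 0"
  proof -
    let ?B = "\<lambda>n::nat. box (- real n *\<^sub>R One) (real n *\<^sub>R One) :: 'a set"
    have "(\<lambda>n. LINT x:?B n|lborel. f x) \<longlonglongrightarrow> (LINT x:(\<Union>n. ?B n)|lborel. f x)"
    proof (rule set_integral_cont_up)
      show "incseq ?B"
        unfolding incseq_def by (force simp: mem_box intro: less_le_trans le_less_trans)
    qed (auto intro!: si)
    moreover have "(\<Union>n. ?B n) = UNIV"
      using UN_box_eq_UNIV by simp
    ultimately have "(\<lambda>n. 0) \<longlonglongrightarrow> (LINT x:UNIV|lborel. f x)"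
      by (simp only: box)
    then show ?thesis
      by (simp add: LIMSEQ_const_iff set_lebesgue_integral_def)
  qed
  fix A :: "'a set" assume "A \<in> sets lborel"
  then have "A \<in> sigma_sets UNIV (range (\<lambda>(a, b). box a b))"
    by (simp add: sets_eq)
  from Int_stable_box subset_Pow this show "(LINT x:A|lborel. f x) = 0"
  proof (induction rule: sigma_sets_induct_disjoint)
    case (compl A)
    then have [measurable]: "A \<in> sets borel"
      by (simp add: sets_eq)
    have "(LINT x:A \<union> - A|lborel. f x) = (LINT x:A|lborel. f x) + (LINT x:-A|lborel. f x)"
      by (intro set_integral_Un si) auto
    then show ?case
      using compl total by (simp add: set_lebesgue_integral_def Compl_eq_Diff_UNIV)
  next
    case (union A)
    then have "A i \<in> sets borel" for i
      by (auto simp: sets_eq)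
    then show ?case
      using union by (subst lebesgue_integral_countable_add)
        (auto simp: disjoint_family_on_def intro!: si)
  next
    case (basic A)
    then show ?case
      using box by auto
  qed (simp add: set_lebesgue_integral_def)
qed

section \<open>Affine changes of variables in the plane\<close>

lemma lborel_prod_affine:
  fixes t :: "real \<times> real"
  assumes "a \<noteq> 0" "b \<noteq> 0"
  shows "lborel = density (distr lborel borel (\<lambda>x. t + (a * fst x, b * snd x)))
    (\<lambda>_. ennreal \<bar>a * b\<bar>)"
proof -
  have "lborel = density (distr lborel borel
      (\<lambda>x. t + (\<Sum>j\<in>Basis. ((if j = (1, 0) then a else b) * (x \<bullet> j)) *\<^sub>R j)))
      (\<lambda>_. ennreal (\<Prod>j\<in>(Basis :: (real \<times> real) set). \<bar>if j = (1, 0) then a else b\<bar>))"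
    by (rule lborel_affine_euclidean[where c = "\<lambda>j. if j = (1, 0) then a else b" and t = t])
      (use assms in auto)
  then show ?thesis
    by (simp add: Basis_prod_def abs_mult plus_prod_def inner_prod_def mult.commute)
qed

text \<open>Equal factors serve to dilate the Gaussian; the factors \<open>inverse b1\<close> and
  \<open>inverse b2\<close> account for the rescaled frequencies of the canonical transform.\<close>

lemma
  fixes f :: "real \<times> real \<Rightarrow> 'b::{banach, second_countable_topology}" and t :: "real \<times> real"
  assumes f [measurable]: "f \<in> borel_measurable borel" and ab: "a \<noteq> 0" "b \<noteq> 0"
  shows integral_lborel_prod_affine:
      "(LINT x|lborel. f x) = \<bar>a * b\<bar> *\<^sub>R (LINT x|lborel. f (t + (a * fst x, b * snd x)))" (is ?int)
    and integrable_lborel_prod_affine_iff: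
      "integrable lborel f \<longleftrightarrow> integrable lborel (\<lambda>x. f (t + (a * fst x, b * snd x)))" (is ?iff)
proof -
  let ?D = "distr lborel borel (\<lambda>x. t + (a * fst x, b * snd x))"
  have [measurable]: "(\<lambda>x. t + (a * fst x, b * snd x)) \<in> borel \<rightarrow>\<^sub>M borel"
    by (intro borel_measurable_continuous_onI continuous_intros)
  have eq: "lborel = density ?D (\<lambda>_. ennreal \<bar>a * b\<bar>)"
    by (rule lborel_prod_affine[OF ab])
  have "(LINT x|lborel. f x) = (LINT x|density ?D (\<lambda>_. ennreal \<bar>a * b\<bar>). f x)"
    using eq by (rule arg_cong)
  also have "\<dots> = (LINT x|?D. \<bar>a * b\<bar> *\<^sub>R f x)"
    by (rule integral_density) auto
  also have "\<dots> = \<bar>a * b\<bar> *\<^sub>R (LINT x|lborel. f (t + (a * fst x, b * snd x)))"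
    by (subst integral_distr) auto
  finally show ?int .
  have "integrable lborel f \<longleftrightarrow> integrable (density ?D (\<lambda>_. ennreal \<bar>a * b\<bar>)) f"
    using eq by (rule arg_cong)
  also have "\<dots> \<longleftrightarrow> integrable ?D (\<lambda>x. \<bar>a * b\<bar> *\<^sub>R f x)"
    by (rule integrable_density) auto
  also have "\<dots> \<longleftrightarrow> integrable lborel (\<lambda>x. f (t + (a * fst x, b * snd x)))"
    using ab integrable_scaleR_right[of "inverse \<bar>a * b\<bar>" lborel
        "\<lambda>x. \<bar>a * b\<bar> *\<^sub>R f (t + (a * fst x, b * snd x))"]
    by (subst integrable_distr_eq) auto
  finally show ?iff .
qed

section \<open>The planar Gaussian and its Fourier transform\<close>

text \<open>The planar standard normal density without its factor 1/(2 pi): the value at 0 is 1, so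
  \<open>gauss\<close> of e times w tends to 1 as e tends to 0, and the total mass is 2 pi.\<close>

definition gauss :: "real \<times> real \<Rightarrow> real"
  where "gauss x = exp (- (norm x)\<^sup>2 / 2)"

lemma gauss_nonneg [simp]: "0 \<le> gauss x" and gauss_le_1 [simp]: "gauss x \<le> 1"
  by (simp_all add: gauss_def)

lemma gauss_0 [simp]: "gauss 0 = 1"
  by (simp add: gauss_def)

lemma borel_measurable_gauss [measurable]: "gauss \<in> borel_measurable borel"
  unfolding gauss_def[abs_def] by measurable

lemma gauss_Pair: "gauss (x, y) = 2 * pi * (std_normal_density x * std_normal_density y)"
  by (simp add: gauss_def std_normal_density_def norm_Pair exp_add[symmetric] add_divide_distrib)

text \<open>The left side is the characteristic function of the standard normal
  distribution.\<close>

lemma integral_std_normal_density_cis: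
  "(LINT x|lborel. of_real (std_normal_density x) * cis (t * x)) = of_real (exp (- t\<^sup>2 / 2))"
proof -
  have "(LINT x|lborel. of_real (std_normal_density x) * cis (t * x)) =
      (LINT x|std_normal_distribution. cis (t * x))"
    by (subst integral_density) (auto simp: scaleR_conv_of_real)
  also have "\<dots> = char std_normal_distribution t"
    by (simp add: char_def cis_conv_exp)
  finally show ?thesis
    by (simp add: char_std_normal_distribution)
qed

lemma integrable_std_normal_density_cis:
  "integrable lborel (\<lambda>x. of_real (std_normal_density x) * cis (t * x))"
  by (rule Bochner_Integration.integrable_bound[where f = std_normal_density])
    (auto simp: norm_mult)

text \<open>Both the Gaussian and the plane wave split into factors in single coordinates, so Fubini
  leaves a product of two normal characteristic functions.\<close>

lemma
  shows integrable_gauss_cis: "integrable lborel (\<lambda>w. of_real (gauss w) * cis (w \<bullet> s))"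
    and integral_gauss_cis:
      "(LINT w|lborel. of_real (gauss w) * cis (w \<bullet> s)) = of_real (2 * pi * gauss s)"
proof -
  obtain a b where s: "s = (a, b)"
    by fastforce
  let ?F = "\<lambda>t x. complex_of_real (std_normal_density x) * cis (t * x)"
  have eq: "of_real (gauss (x, y)) * cis ((x, y) \<bullet> s) = of_real (2 * pi) * (?F a x * ?F b y)" for x y
    by (simp add: s gauss_Pair cis_mult[symmetric] mult_ac)
  have "integrable (lborel \<Otimes>\<^sub>M lborel) (\<lambda>(x, y). ?F a x * ?F b y)"
    by (intro lborel_pair.Fubini_integrable)
      (auto simp: norm_mult intro!: integrable_mult_right integrable_std_normal_density_cis)
  then have int: "integrable (lborel \<Otimes>\<^sub>M lborel)
      (\<lambda>(x, y). of_real (gauss (x, y)) * cis ((x, y) \<bullet> s))"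
    unfolding eq case_prod_beta by (intro integrable_mult_right)
  then show "integrable lborel (\<lambda>w. of_real (gauss w) * cis (w \<bullet> s))"
    unfolding case_prod_beta prod.collapse lborel_prod .
  have "(LINT w|lborel. of_real (gauss w) * cis (w \<bullet> s)) =
      (LINT (x, y)|(lborel \<Otimes>\<^sub>M lborel). of_real (gauss (x, y)) * cis ((x, y) \<bullet> s))"
    unfolding case_prod_beta prod.collapse lborel_prod ..
  also have "\<dots> = (LINT x|lborel. LINT y|lborel. of_real (gauss (x, y)) * cis ((x, y) \<bullet> s))"
    by (rule lborel_pair.integral_fst[OF int, symmetric])
  also have "\<dots> = of_real (2 * pi) * (exp (- a\<^sup>2 / 2) * exp (- b\<^sup>2 / 2))"
    unfolding eq by (simp add: integral_std_normal_density_cis)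
  also have "\<dots> = of_real (2 * pi * gauss s)"
    by (simp add: s gauss_def norm_Pair exp_add[symmetric] add_divide_distrib)
  finally show "(LINT w|lborel. of_real (gauss w) * cis (w \<bullet> s)) = of_real (2 * pi * gauss s)" .
qed

lemma integrable_gauss: "integrable lborel gauss" and integral_gauss: "integral\<^sup>L lborel gauss = 2 * pi"
proof -
  show int: "integrable lborel gauss"
    using integrable_norm[OF integrable_gauss_cis[of 0]] by simp
  show "integral\<^sup>L lborel gauss = 2 * pi"
    using integral_gauss_cis[of 0] by (simp flip: of_real_mult)
qed

section \<open>The planar Fourier transform and its Gaussian regularisation\<close>

text \<open>No power of 2 pi is put in front, so inversion and Plancherel carry the factor 4
  pi^2.\<close>

definition fourier :: "(real \<times> real \<Rightarrow> complex) \<Rightarrow> real \<times> real \<Rightarrow> complex"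
  where "fourier h w = (LINT x|lborel. h x * cis (- (w \<bullet> x)))"

lemma borel_measurable_fourier [measurable]:
  assumes [measurable]: "h \<in> borel_measurable borel"
  shows "fourier h \<in> borel_measurable borel"
  unfolding fourier_def[abs_def] by measurable

lemma integrable_mult_cis:
  assumes "integrable lborel h" and [measurable]: "g \<in> borel_measurable borel"
  shows "integrable lborel (\<lambda>x. h x * cis (g x))"
  by (rule Bochner_Integration.integrable_bound[OF assms(1)]) (use assms in \<open>auto simp: norm_mult\<close>)

lemma integrable_gauss_scaled:
  assumes "e > 0"
  shows "integrable lborel (\<lambda>w. gauss (e *\<^sub>R w))"
  using integrable_lborel_prod_affine_iff[of gauss e e 0] integrable_gauss assms
  by (simp add: scaleR_prod_def)

text \<open>Replacing w by e w and s by s/e preserves the inner product, so only the Jacobian e^2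
  separates this from the unscaled transform.\<close>

lemma integral_gauss_scaled_cis:
  assumes e: "e > 0"
  shows "(LINT w|lborel. of_real (gauss (e *\<^sub>R w)) * cis (w \<bullet> s)) =
    of_real (2 * pi / e\<^sup>2 * gauss (s /\<^sub>R e))"
proof -
  have scale: "(e * fst w, e * snd w) = e *\<^sub>R w" for w :: "real \<times> real"
    by (simp add: scaleR_prod_def)
  have inner: "(e *\<^sub>R w) \<bullet> (s /\<^sub>R e) = w \<bullet> s" for w
    using e by simp
  have "(LINT w|lborel. of_real (gauss w) * cis (w \<bullet> (s /\<^sub>R e))) =
      e\<^sup>2 * (LINT w|lborel. of_real (gauss (e *\<^sub>R w)) * cis (w \<bullet> s))"
    using integral_lborel_prod_affine[of "\<lambda>w. of_real (gauss w) * cis (w \<bullet> (s /\<^sub>R e))" e e 0] e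
    by (simp add: scale inner power2_eq_square scaleR_conv_of_real del: inner_simps)
  then show ?thesis
    using e by (simp add: integral_gauss_cis eq_divide_eq mult_ac del: inner_simps)
qed

text \<open>The Gaussian factor makes the double integral over w and y absolutely convergent. After
  exchanging the order, the integral over w is the transform of a dilated Gaussian at x - y.\<close>

lemma fourier_gauss_smoothing:
  assumes h: "integrable lborel h" and e: "e > 0"
  shows "(LINT w|lborel. fourier h w * cis (w \<bullet> x) * of_real (gauss (e *\<^sub>R w))) =
    (LINT y|lborel. h y * of_real (2 * pi / e\<^sup>2 * gauss ((x - y) /\<^sub>R e)))"
proof -
  note [measurable] = borel_measurable_integrable[OF h, simplified]
  have cis_eq: "cis (w \<bullet> (x - y)) = cis (w \<bullet> x) * cis (- (w \<bullet> y))" for w y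
    by (simp add: cis_mult inner_diff_right)
  let ?H = "\<lambda>w y. h y * (of_real (gauss (e *\<^sub>R w)) * cis (w \<bullet> (x - y)))"
  have "integrable lborel (\<lambda>w. \<integral>y. norm (h y) * gauss (e *\<^sub>R w) \<partial>lborel)"
    using integrable_gauss_scaled[OF e] by simp
  then have int: "integrable (lborel \<Otimes>\<^sub>M lborel) (case_prod ?H)"
    by (intro lborel_pair.Fubini_integrable)
      (auto simp: norm_mult h mult.assoc[symmetric] intro!: integrable_mult_cis integrable_mult_left)
  have "(LINT w|lborel. fourier h w * cis (w \<bullet> x) * of_real (gauss (e *\<^sub>R w))) =
      (LINT w|lborel. LINT y|lborel. ?H w y)"
    unfolding fourier_def mult.assoc cis_eq
    by (subst integral_mult_left_zero[symmetric]) (simp add: mult_ac)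
  also have "\<dots> = (LINT y|lborel. LINT w|lborel. ?H w y)"
    by (rule lborel_pair.Fubini_integral[OF int, symmetric])
  also have "\<dots> = (LINT y|lborel. h y * of_real (2 * pi / e\<^sup>2 * gauss ((x - y) /\<^sub>R e)))"
    using e by (simp add: integral_gauss_scaled_cis)
  finally show ?thesis .
qed

section \<open>Fourier inversion through a Gaussian approximate identity\<close>

text \<open>Supplies the product majorants for the Fubini exchanges in inversion and in Plancherel's
  theorem.\<close>

lemma integrable_lborel_pair_mult:
  fixes f :: "'a::euclidean_space \<Rightarrow> 'c::{real_normed_field, banach, second_countable_topology}"
    and g :: "'b::euclidean_space \<Rightarrow> 'c"
  assumes f: "integrable lborel f" and g: "integrable lborel g"
  shows "integrable (lborel \<Otimes>\<^sub>M lborel) (\<lambda>(x, y). f x * g y)"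
proof -
  note [measurable] = borel_measurable_integrable[OF f] borel_measurable_integrable[OF g]
  show ?thesis
    by (intro lborel_pair.Fubini_integrable)
      (auto simp: norm_mult intro!: integrable_mult_right integrable_mult_left integrable_norm f g)
qed

text \<open>Substituting x = y + e s gives the Jacobian e^2, which cancels the normalisation of the
  kernel and moves e into the argument of \<open>f\<close>, where a limit can be taken.\<close>

lemma integral_gauss_kernel:
  fixes f :: "real \<times> real \<Rightarrow> real"
  assumes [measurable]: "f \<in> borel_measurable borel" and e: "e > 0"
  shows "(LINT x|lborel. f x * (2 * pi / e\<^sup>2 * gauss ((x - y) /\<^sub>R e))) =
    2 * pi * (LINT s|lborel. f (y + e *\<^sub>R s) * gauss s)"
proof -
  have scale: "(e * fst w, e * snd w) = e *\<^sub>R w" for w :: "real \<times> real"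
    by (simp add: scaleR_prod_def)
  define c where "c = 2 * pi / e\<^sup>2"
  have "(LINT x|lborel. f x * (c * gauss ((x - y) /\<^sub>R e))) =
      e\<^sup>2 * (LINT s|lborel. c * (f (y + e *\<^sub>R s) * gauss s))"
    using e by (subst integral_lborel_prod_affine[where a = e and b = e and t = y])
      (simp_all add: scale power2_eq_square mult_ac del: integral_mult_right_zero integral_mult_left_zero)
  also have "\<dots> = 2 * pi * (LINT s|lborel. f (y + e *\<^sub>R s) * gauss s)"
    using e by (simp add: c_def)
  finally show ?thesis
    unfolding c_def .
qed

text \<open>Off the frontier the indicator is continuous at \<open>y\<close>, so the integrands
  converge for each s, with \<open>gauss\<close> itself as majorant.\<close>

lemma tendsto_integral_indicator_gauss:
  fixes U :: "(real \<times> real) set"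
  assumes [measurable]: "U \<in> sets borel" and y: "y \<notin> frontier U" and e: "e \<longlonglongrightarrow> 0"
  shows "(\<lambda>n. LINT s|lborel. indicator U (y + e n *\<^sub>R s) * gauss s) \<longlonglongrightarrow> indicator U y * (2 * pi)"
proof -
  have "(\<lambda>n. LINT s|lborel. indicator U (y + e n *\<^sub>R s) * gauss s) \<longlonglongrightarrow>
      (LINT s|lborel. indicator U y * gauss s)"
  proof (rule integral_dominated_convergence[where w = gauss])
    show "AE s in lborel. (\<lambda>n. indicator U (y + e n *\<^sub>R s) * gauss s) \<longlonglongrightarrow> indicator U y * gauss s"
    proof (rule AE_I2)
      fix s :: "real \<times> real"
      have "(\<lambda>n. y + e n *\<^sub>R s) \<longlonglongrightarrow> y + 0 *\<^sub>R s"
        by (intro tendsto_intros e)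
      then have "(\<lambda>n. indicator U (y + e n *\<^sub>R s) :: real) \<longlonglongrightarrow> indicator U y"
        using y by (intro isCont_tendsto_compose[of y "indicator U"]) (auto simp: isCont_indicator)
      then show "(\<lambda>n. indicator U (y + e n *\<^sub>R s) * gauss s) \<longlonglongrightarrow> indicator U y * gauss s"
        by (intro tendsto_intros)
    qed
  qed (auto intro: integrable_gauss simp: indicator_def)
  then show ?thesis
    by (simp add: integral_gauss)
qed

text \<open>Both sides are limits of the integrals over the box of the regularised inverse transform
  \<open>K n\<close>: one on removing the regularisation directly, the other after rewriting it as a
  convolution.\<close>

lemma fourier_inversion_box:
  assumes h: "integrable lborel h" and fh: "integrable lborel (fourier h)"
  shows "(LINT x:box a b|lborel. LINT w|lborel. fourier h w * cis (w \<bullet> x)) =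
    (LINT x:box a b|lborel. of_real (4 * pi\<^sup>2) * h x)"
proof -
  note [measurable] = borel_measurable_integrable[OF h, simplified]
  let ?U = "box a b"
  \<comment> \<open>A sequence of scales, because dominated convergence is applied along sequences;
    the shift by one keeps every scale positive.\<close>
  define e where "e n = inverse (real (Suc n))" for n
  have e0: "e n > 0" for n
    by (simp add: e_def)
  have e_lim: "e \<longlonglongrightarrow> 0"
    unfolding e_def by (rule LIMSEQ_inverse_real_of_nat)
  define K where "K n x = (LINT w|lborel. fourier h w * cis (w \<bullet> x) * of_real (gauss (e n *\<^sub>R w)))" for n x
  have [measurable]: "K n \<in> borel_measurable borel" for n
    unfolding K_def[abs_def] by measurable
  \<comment> \<open>Since \<open>gauss\<close> is at most 1, this bound is uniform in
    \<open>n\<close> and \<open>x\<close>, hence a majorant on the box, which has finite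
    measure.\<close>
  have K_bound: "norm (K n x) \<le> (LINT w|lborel. norm (fourier h w))" for n x
    unfolding K_def
    by (intro Bochner_Integration.integral_norm_bound_integral Bochner_Integration.integrable_bound[OF fh])
      (auto simp: norm_mult mult_left_le fh)
  have K_lim: "(\<lambda>n. K n x) \<longlonglongrightarrow> (LINT w|lborel. fourier h w * cis (w \<bullet> x))" for x
    unfolding K_def
  proof (rule integral_dominated_convergence[where w = "\<lambda>w. norm (fourier h w)"])
    show "AE w in lborel. (\<lambda>n. fourier h w * cis (w \<bullet> x) * of_real (gauss (e n *\<^sub>R w))) \<longlonglongrightarrow>
        fourier h w * cis (w \<bullet> x)"
    proof (rule AE_I2)
      fix w
      have "(\<lambda>n. fourier h w * cis (w \<bullet> x) * of_real (gauss (e n *\<^sub>R w))) \<longlonglongrightarrow>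
          fourier h w * cis (w \<bullet> x) * of_real (exp (- (norm (0 *\<^sub>R w))\<^sup>2 / 2))"
        unfolding gauss_def by (intro tendsto_intros e_lim) simp
      then show "(\<lambda>n. fourier h w * cis (w \<bullet> x) * of_real (gauss (e n *\<^sub>R w))) \<longlonglongrightarrow>
          fourier h w * cis (w \<bullet> x)"
        by simp
    qed
  qed (auto simp: norm_mult mult_left_le fh)
  have lim1: "(\<lambda>n. LINT x:?U|lborel. K n x) \<longlonglongrightarrow>
      (LINT x:?U|lborel. LINT w|lborel. fourier h w * cis (w \<bullet> x))"
    unfolding set_lebesgue_integral_def
  proof (rule integral_dominated_convergence
      [where w = "\<lambda>x. indicator ?U x * (LINT w|lborel. norm (fourier h w))"])
    show "integrable lborel (\<lambda>x. indicator ?U x * (LINT w|lborel. norm (fourier h w)))"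
      by (intro integrable_mult_left integrable_indicator_box)
    show "AE x in lborel. norm (indicator ?U x *\<^sub>R K n x) \<le>
        indicator ?U x * (LINT w|lborel. norm (fourier h w))" for n
      using K_bound[of n] by (auto simp: indicator_def)
    show "AE x in lborel. (\<lambda>n. indicator ?U x *\<^sub>R K n x) \<longlonglongrightarrow>
        indicator ?U x *\<^sub>R (LINT w|lborel. fourier h w * cis (w \<bullet> x))"
      by (intro AE_I2 tendsto_intros K_lim)
  qed auto
  \<comment> \<open>The box indicator averaged against the Gaussian at scale \<open>e n\<close>, up
    to the total mass 2 pi.\<close>
  define P where "P n y = (LINT s|lborel. indicator ?U (y + e n *\<^sub>R s) * gauss s)" for n y
  have [measurable]: "P n \<in> borel_measurable borel" for n
    unfolding P_def[abs_def] by measurable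
  have P_bound: "\<bar>P n y\<bar> \<le> 2 * pi" for n y
  proof -
    have "norm (P n y) \<le> integral\<^sup>L lborel gauss"
      unfolding P_def
      by (intro Bochner_Integration.integral_norm_bound_integral Bochner_Integration.integrable_bound[OF integrable_gauss])
        (auto simp: integrable_gauss indicator_def)
    then show ?thesis
      by (simp add: integral_gauss)
  qed
  have K_P: "(LINT x:?U|lborel. K n x) = (LINT y|lborel. h y * of_real (2 * pi * P n y))" for n
  proof -
    define q where "q s = 2 * pi / (e n)\<^sup>2 * gauss (s /\<^sub>R e n)" for s
    have [measurable]: "q \<in> borel_measurable borel"
      unfolding q_def[abs_def] by measurable
    have q_bound: "\<bar>q s\<bar> \<le> 2 * pi / (e n)\<^sup>2" for s
      unfolding q_def by (simp add: abs_mult mult_left_le divide_right_mono)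
    let ?H = "\<lambda>y x. h y * of_real (indicator ?U x * q (x - y))"
    \<comment> \<open>Bounding the Gaussian kernel by its value at 0 gives a majorant of product
      form. It depends on \<open>n\<close>, which does no harm because \<open>n\<close> is fixed in
      this exchange.\<close>
    have "integrable (lborel \<Otimes>\<^sub>M lborel)
        (\<lambda>(y, x). h y * of_real (indicator ?U x * (2 * pi / (e n)\<^sup>2)))"
      by (intro integrable_lborel_pair_mult h integrable_of_real integrable_mult_left
        integrable_indicator_box)
    moreover have "norm (?H y x) \<le> norm (h y * of_real (indicator ?U x * (2 * pi / (e n)\<^sup>2)))" for x y
      unfolding norm_mult norm_of_real using q_bound[of "x - y"]
      by (intro mult_left_mono) (auto simp: indicator_def abs_mult)
    ultimately have int: "integrable (lborel \<Otimes>\<^sub>M lborel) (case_prod ?H)"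
      by (elim Bochner_Integration.integrable_bound) (measurable, auto)
    have "(LINT x:?U|lborel. K n x) = (LINT x|lborel. LINT y|lborel. ?H y x)"
      unfolding set_lebesgue_integral_def K_def fourier_gauss_smoothing[OF h e0] q_def
      by (subst integral_scaleR_right[symmetric]) (simp add: scaleR_conv_of_real mult_ac)
    also have "\<dots> = (LINT y|lborel. LINT x|lborel. ?H y x)"
      by (rule lborel_pair.Fubini_integral[OF int])
    also have "\<dots> = (LINT y|lborel. h y * of_real (LINT x|lborel. indicator ?U x * q (x - y)))"
      by (simp only: integral_mult_right_zero integral_complex_of_real)
    also have "\<dots> = (LINT y|lborel. h y * of_real (2 * pi * P n y))"
      unfolding q_def P_def by (subst integral_gauss_kernel) (auto simp: e0)
    finally show ?thesis .
  qed
  have lim2: "(\<lambda>n. LINT y|lborel. h y * of_real (2 * pi * P n y)) \<longlonglongrightarrow>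
      (LINT y|lborel. h y * of_real (2 * pi * (indicator ?U y * (2 * pi))))"
  proof (rule integral_dominated_convergence[where w = "\<lambda>y. norm (h y) * (4 * pi\<^sup>2)"])
    \<comment> \<open>A box is convex, so its frontier is negligible and the exceptional points of
      the pointwise limit form a null set.\<close>
    have "frontier ?U \<in> null_sets lborel"
      using negligible_convex_frontier[OF convex_box(2), of a b]
      by (simp add: negligible_iff_null_sets null_sets_completion_iff)
    then have "AE y in lborel. y \<notin> frontier ?U"
      by (rule AE_not_in)
    then show "AE y in lborel. (\<lambda>n. h y * of_real (2 * pi * P n y)) \<longlonglongrightarrow>
        h y * of_real (2 * pi * (indicator ?U y * (2 * pi)))"
    proof eventually_elim
      case (elim y)
      show ?case
        unfolding P_def
        by (intro tendsto_intros tendsto_integral_indicator_gauss elim e_lim) auto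
    qed
    show "AE y in lborel. norm (h y * of_real (2 * pi * P n y)) \<le> norm (h y) * (4 * pi\<^sup>2)" for n
    proof (rule AE_I2)
      fix y
      have "\<bar>2 * pi * P n y\<bar> \<le> 4 * pi\<^sup>2"
        using mult_left_mono[OF P_bound[of n y], of "2 * pi"] by (simp add: abs_mult power2_eq_square)
      then show "norm (h y * of_real (2 * pi * P n y)) \<le> norm (h y) * (4 * pi\<^sup>2)"
        unfolding norm_mult norm_of_real by (intro mult_left_mono) auto
    qed
  qed (use h in auto)
  have "(LINT x:?U|lborel. LINT w|lborel. fourier h w * cis (w \<bullet> x)) =
      (LINT y|lborel. h y * of_real (2 * pi * (indicator ?U y * (2 * pi))))"
    using lim1 lim2 unfolding K_P by (rule LIMSEQ_unique)
  also have "\<dots> = (LINT x:?U|lborel. of_real (4 * pi\<^sup>2) * h x)"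
    unfolding set_lebesgue_integral_def
    by (simp add: scaleR_conv_of_real power2_eq_square mult_ac)
  finally show ?thesis .
qed

text \<open>The difference \<open>d\<close> of the two sides has vanishing integral over every box,
  so it is null on each of countably many boxes exhausting the plane.\<close>

theorem fourier_inversion:
  assumes h: "integrable lborel h" and fh: "integrable lborel (fourier h)"
  shows "AE x in lborel. (LINT w|lborel. fourier h w * cis (w \<bullet> x)) = of_real (4 * pi\<^sup>2) * h x"
proof -
  note [measurable] = borel_measurable_integrable[OF h, simplified]
  define d where "d x = (LINT w|lborel. fourier h w * cis (w \<bullet> x)) - of_real (4 * pi\<^sup>2) * h x" for x
  have si: "set_integrable lborel (box a b) (\<lambda>x. LINT w|lborel. fourier h w * cis (w \<bullet> x))"
      "set_integrable lborel (box a b) (\<lambda>x. of_real (4 * pi\<^sup>2) * h x)" for a b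
  proof -
    \<comment> \<open>The inverse transform is bounded by the L1 norm of \<open>fourier h\<close>,
      which makes it integrable over boxes.\<close>
    have "norm (LINT w|lborel. fourier h w * cis (w \<bullet> x)) \<le> (LINT w|lborel. norm (fourier h w))" for x
      by (rule order_trans[OF integral_norm_bound]) (simp add: norm_mult)
    then have *: "norm (indicat_real (box a b) x *\<^sub>R (LINT w|lborel. fourier h w * cis (w \<bullet> x)))
        \<le> norm (indicat_real (box a b) x * (LINT w|lborel. norm (fourier h w)))" for x
      by (simp add: indicator_def)
    have "integrable lborel (\<lambda>x. indicat_real (box a b) x * (LINT w|lborel. norm (fourier h w)))"
      by (intro integrable_mult_left integrable_indicator_box)
    then show "set_integrable lborel (box a b) (\<lambda>x. LINT w|lborel. fourier h w * cis (w \<bullet> x))"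
      unfolding set_integrable_def
      by (rule Bochner_Integration.integrable_bound) (simp, intro AE_I2 *)
    show "set_integrable lborel (box a b) (\<lambda>x. of_real (4 * pi\<^sup>2) * h x)"
      unfolding set_integrable_def using h by (intro integrable_mult_indicator) auto
  qed
  have d_box: "(LINT x:box a b|lborel. d x) = 0" for a b
    unfolding d_def set_integral_diff(2)[OF si] fourier_inversion_box[OF h fh] by simp
  have d_int: "set_integrable lborel (box a b) d" for a b
    unfolding d_def[abs_def] by (intro set_integral_diff(1) si)
  (* The inverse transform is a priori only locally integrable, hence the cut-off. *)
  let ?B = "\<lambda>n::nat. box (- real n *\<^sub>R One) (real n *\<^sub>R One) :: (real \<times> real) set"
  have "AE x in lborel. indicat_real (?B n) x *\<^sub>R d x = 0" for n
  proof (rule AE_eq_0_if_box_integrals_eq_0)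
    show "integrable lborel (\<lambda>x. indicat_real (?B n) x *\<^sub>R d x)"
      using d_int unfolding set_integrable_def .
    fix a b :: "real \<times> real"
    \<comment> \<open>Boxes meet in boxes, so integrating the cut-off function over a box is again a
      box integral of \<open>d\<close>.\<close>
    obtain a' b' where "box a b \<inter> ?B n = box a' b'"
      using box_Int_box by blast
    then show "(LINT x:box a b|lborel. indicat_real (?B n) x *\<^sub>R d x) = 0"
      using d_box[of a' b']
      by (simp add: set_lebesgue_integral_def mult.commute flip: indicator_inter_arith)
  qed
  then have "AE x in lborel. \<forall>n. indicat_real (?B n) x *\<^sub>R d x = 0"
    by (subst AE_all_countable) blast
  then show ?thesis
  proof eventually_elim
    case (elim x)
    obtain n where "x \<in> ?B n"
      using UN_box_eq_UNIV[where 'a = "real \<times> real"] by auto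
    with elim[rule_format, of n] show ?case
      by (simp add: d_def)
  qed
qed

section \<open>Plancherel's theorem\<close>

text \<open>In the product of \<open>fourier h\<close> with its conjugate, the conjugate is expanded
  as an integral of \<open>cnj (h x)\<close>. Exchanging the integrals leaves the inverse transform
  of \<open>fourier h\<close>, which inversion replaces by 4 pi^2 times \<open>h\<close>.\<close>

theorem plancherel:
  assumes h: "integrable lborel h" and fh: "integrable lborel (fourier h)"
  shows "(LINT w|lborel. (norm (fourier h w))\<^sup>2) = 4 * pi\<^sup>2 * (LINT x|lborel. (norm (h x))\<^sup>2)"
proof -
  note [measurable] = borel_measurable_integrable[OF h, simplified]
  let ?H = "\<lambda>w x. fourier h w * cnj (h x) * cis (w \<bullet> x)"
  have "integrable (lborel \<Otimes>\<^sub>M lborel) (\<lambda>(w, x). fourier h w * cnj (h x))"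
    by (intro integrable_lborel_pair_mult fh integrable_cnj h)
  then have int: "integrable (lborel \<Otimes>\<^sub>M lborel) (case_prod ?H)"
    by (rule Bochner_Integration.integrable_bound) (auto simp: norm_mult)
  have cnj_fourier: "cnj (fourier h w) = (LINT x|lborel. cnj (h x) * cis (w \<bullet> x))" for w
    unfolding fourier_def by (subst Bochner_Integration.integral_cnj[symmetric]) (simp add: cis_cnj)
  have "of_real (LINT w|lborel. (norm (fourier h w))\<^sup>2) = (LINT w|lborel. fourier h w * cnj (fourier h w))"
    by (simp only: complex_norm_square[symmetric] integral_complex_of_real)
  also have "\<dots> = (LINT w|lborel. LINT x|lborel. ?H w x)"
    unfolding cnj_fourier by (simp add: mult.assoc)
  also have "\<dots> = (LINT x|lborel. LINT w|lborel. ?H w x)"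
    by (rule lborel_pair.Fubini_integral[OF int, symmetric])
  also have "\<dots> = (LINT x|lborel. cnj (h x) * (LINT w|lborel. fourier h w * cis (w \<bullet> x)))"
    by (subst integral_mult_right_zero[symmetric]) (simp add: mult_ac)
  also have "\<dots> = (LINT x|lborel. of_real (4 * pi\<^sup>2 * (norm (h x))\<^sup>2))"
  proof (rule integral_cong_AE)
    show "AE x in lborel. cnj (h x) * (LINT w|lborel. fourier h w * cis (w \<bullet> x)) =
        of_real (4 * pi\<^sup>2 * (norm (h x))\<^sup>2)"
      using fourier_inversion[OF h fh]
      by eventually_elim (simp only: complex_norm_square of_real_mult mult_ac)
  qed auto
  also have "\<dots> = of_real (4 * pi\<^sup>2 * (LINT x|lborel. (norm (h x))\<^sup>2))"
    unfolding integral_complex_of_real by simp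
  finally show ?thesis
    by (simp only: of_real_eq_iff)
qed

section \<open>Reduction of the canonical transform to the Fourier transform\<close>

text \<open>Members of \<open>Lp_H_mu\<close> are only Lebesgue measurable, whereas the Fourier
  theory above works with \<open>lborel\<close> and Borel functions; this is the passage between
  them.\<close>

lemma lebesgue_complex_ex_borel:
  fixes g :: "'a::euclidean_space \<Rightarrow> complex"
  assumes [measurable]: "g \<in> borel_measurable lebesgue"
  obtains g' where "g' \<in> borel_measurable borel" "AE x in lborel. g x = g' x"
proof -
  obtain r where r: "r \<in> borel_measurable lborel" "AE x in lborel. Re (g x) = r x"
    using completion_ex_borel_measurable_real[of "\<lambda>x. Re (g x)" lborel] by auto
  obtain s where s: "s \<in> borel_measurable lborel" "AE x in lborel. Im (g x) = s x"
    using completion_ex_borel_measurable_real[of "\<lambda>x. Im (g x)" lborel] by auto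
  note [measurable] = r(1)[simplified] s(1)[simplified]
  have "(\<lambda>x. of_real (r x) + \<i> * of_real (s x)) \<in> borel_measurable borel"
    by measurable
  moreover have "AE x in lborel. g x = of_real (r x) + \<i> * of_real (s x)"
    using r(2) s(2) by eventually_elim (simp add: complex_eq_iff)
  ultimately show thesis
    by (rule that)
qed

text \<open>Allows \<open>of_complex\<close> to be pulled out of the integral defining
  \<open>qlct\<close>; the bound 1 comes from \<open>of_complex\<close> being an isometry.\<close>

lemma bounded_linear_of_complex: "bounded_linear of_complex"
  by (intro bounded_linear_intro[where K = 1])
    (simp_all add: of_complex_add norm_of_complex,
      simp add: of_complex_def quat_eq_iff mu_def of_real_def)

lemma norm_sq_inverse_csqrt:
  "(cmod (1 / csqrt (of_real (2 * pi * b) * \<i>)))\<^sup>2 = 1 / (2 * pi * \<bar>b\<bar>)"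
  by (simp add: norm_divide norm_mult power_divide)

text \<open>The first factor depends on the output variable \<open>u\<close> only; the second holds
  the input chirp and the plane wave of frequency u/b.\<close>

lemma lct_kernel_eq:
  "lct_kernel A x u =
    of_complex (1 / csqrt (of_real (2 * pi * A $ 1 $ 2) * \<i>) * cis (A $ 2 $ 2 / (2 * A $ 1 $ 2) * u\<^sup>2)) *
    of_complex (cis (A $ 1 $ 1 / (2 * A $ 1 $ 2) * x\<^sup>2) * cis (- (u / A $ 1 $ 2 * x)))"
proof -
  have "exp (\<i> * of_real (A $ 1 $ 1 / (2 * A $ 1 $ 2) * x\<^sup>2 - 1 / A $ 1 $ 2 * x * u +
      A $ 2 $ 2 / (2 * A $ 1 $ 2) * u\<^sup>2)) =
    cis (A $ 2 $ 2 / (2 * A $ 1 $ 2) * u\<^sup>2) *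
      (cis (A $ 1 $ 1 / (2 * A $ 1 $ 2) * x\<^sup>2) * cis (- (u / A $ 1 $ 2 * x)))"
    unfolding cis_conv_exp[symmetric] cis_mult by (rule arg_cong[where f = cis]) simp
  then show ?thesis
    by (simp only: lct_kernel_def Let_def of_complex_mult[symmetric] mult.assoc)
qed

theorem corollary1:
  fixes A1 A2 :: "real ^ 2 ^ 2" and f :: "real \<times> real \<Rightarrow> quat"
  assumes "det A1 = 1" and "A1 $ 1 $ 2 \<noteq> 0"
    and "det A2 = 1" and "A2 $ 1 $ 2 \<noteq> 0"
    and "f \<in> Lp_H_mu 1 \<inter> Lp_H_mu 2"
    and "qlct A1 A2 f \<in> Lp_H_mu 1 \<inter> Lp_H_mu 2"
  shows "(LINT \<tau>|lebesgue. (norm (f \<tau>))\<^sup>2) = (LINT w|lebesgue. (norm (qlct A1 A2 f w))\<^sup>2)"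
proof -
  define b1 b2 where "b1 = A1 $ 1 $ 2" and "b2 = A2 $ 1 $ 2"
  have b: "b1 \<noteq> 0" "b2 \<noteq> 0" and b': "inverse b1 \<noteq> 0" "inverse b2 \<noteq> 0"
    using assms by (auto simp: b1_def b2_def)
  define c1 c2 where "c1 = 1 / csqrt (of_real (2 * pi * b1) * \<i>)"
    and "c2 = 1 / csqrt (of_real (2 * pi * b2) * \<i>)"
  \<comment> \<open>The upper left entries of the matrices govern the input phase
    \<open>chirp\<close>, the lower right entries the output phase \<open>chirp'\<close>.\<close>
  define chirp where "chirp z = cis (A1 $ 1 $ 1 / (2 * b1) * (fst z)\<^sup>2) *
    cis (A2 $ 1 $ 1 / (2 * b2) * (snd z)\<^sup>2)" for z :: "real \<times> real"
  define chirp' where "chirp' z = cis (A1 $ 2 $ 2 / (2 * b1) * (fst z)\<^sup>2) *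
    cis (A2 $ 2 $ 2 / (2 * b2) * (snd z)\<^sup>2)" for z :: "real \<times> real"
  have norm_chirp [simp]: "cmod (chirp z) = 1" "cmod (chirp' z) = 1" for z
    by (simp_all add: chirp_def chirp'_def norm_mult)
  have [measurable]: "chirp \<in> borel_measurable borel"
    unfolding chirp_def[abs_def] by (intro borel_measurable_continuous_onI continuous_intros)
  define T where "T w = (inverse b1 * fst w, inverse b2 * snd w)" for w :: "real \<times> real"
  have T_eq: "(\<lambda>w. \<phi> (T w)) = (\<lambda>w. \<phi> (0 + (inverse b1 * fst w, inverse b2 * snd w)))"
    for \<phi> :: "real \<times> real \<Rightarrow> 'c"
    by (simp add: T_def)
  have [measurable]: "T \<in> borel \<rightarrow>\<^sub>M borel"
    unfolding T_def[abs_def] by (intro borel_measurable_continuous_onI continuous_intros)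

  have f: "f \<in> borel_measurable lebesgue" "\<And>z. f z \<in> H_mu" "integrable lebesgue (\<lambda>z. norm (f z))"
    and qf: "integrable lebesgue (\<lambda>z. norm (qlct A1 A2 f z))"
    using assms(5,6) by (auto simp: Lp_H_mu_def powr_one')
  \<comment> \<open>The preimage of \<open>f\<close> under \<open>of_complex\<close>, written with
    inner products so that measurability is inherited from \<open>f\<close>.\<close>
  define g0 where "g0 z = of_real (f z \<bullet> 1) + \<i> * of_real (f z \<bullet> mu)" for z
  have f_g0: "f z = of_complex (g0 z)" for z
    using f(2)[of z]
    by (auto simp: H_mu_def g0_def of_complex_def quat_eq_iff inner_quat_def mu_def of_real_def)
  have g0: "g0 \<in> borel_measurable lebesgue"
    using f(1) unfolding g0_def[abs_def] by measurable
  then obtain g where [measurable]: "g \<in> borel_measurable borel" and g: "AE z in lborel. g0 z = g z"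
    by (rule lebesgue_complex_ex_borel)
  note g' = AE_completion[OF g]
  define h where "h z = g z * chirp z" for z
  have [measurable]: "h \<in> borel_measurable borel"
    unfolding h_def[abs_def] by measurable
  have norm_h: "cmod (h z) = cmod (g z)" for z
    by (simp add: h_def norm_mult)
  have "integrable lebesgue (\<lambda>z. cmod (g0 z))"
    using f(3) by (simp add: f_g0 norm_of_complex)
  then have g0_int: "integrable lebesgue g0"
    using g0 by (simp add: integrable_norm_iff)
  then have "integrable lebesgue g"
    by (rule integrable_cong_AE_imp[OF _ _ g']) (auto intro: measurable_completion)
  then have "integrable lborel g"
    by (simp add: integrable_completion)
  then have h: "integrable lborel h"
    by (rule Bochner_Integration.integrable_bound) (auto simp: norm_h)

  have qlct_eq: "qlct A1 A2 f w = of_complex (c1 * c2 * chirp' w * fourier h (T w))" for w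
  proof -
    let ?k = "c1 * c2 * chirp' w"
    let ?G = "\<lambda>g z. g z * (chirp z * cis (- (T w \<bullet> z)))"
    have int: "integrable lebesgue (?G g0)"
    proof (rule Bochner_Integration.integrable_bound[OF g0_int])
      have "(\<lambda>z. chirp z * cis (- (T w \<bullet> z))) \<in> borel_measurable lebesgue"
        by (rule measurable_completion) measurable
      with g0 show "?G g0 \<in> borel_measurable lebesgue"
        by (rule borel_measurable_times)
    qed (simp add: norm_mult)
    have wave: "cis (- (T w \<bullet> z)) = cis (- (fst w / b1 * fst z)) * cis (- (snd w / b2 * snd z))" for z
      by (simp add: T_def inner_prod_def cis_mult divide_inverse mult_ac)
    \<comment> \<open>All three factors are images under the multiplicative map
      \<open>of_complex\<close>, so the two-sided product can be reordered as a product of complex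
      numbers.\<close>
    have "lct_kernel A1 (fst z) (fst w) * f z * lct_kernel A2 (snd z) (snd w) =
        of_complex (?k * ?G g0 z)" for z
      unfolding wave lct_kernel_eq f_g0 of_complex_mult[symmetric] c1_def c2_def chirp_def chirp'_def
        b1_def b2_def
      by (simp only: mult_ac)
    then have "qlct A1 A2 f w = (LINT z|lebesgue. of_complex (?k * ?G g0 z))"
      by (simp only: qlct_def case_prod_beta case_prod_beta' prod.collapse)
    also have "\<dots> = of_complex (LINT z|lebesgue. ?k * ?G g0 z)"
      by (intro integral_bounded_linear[OF bounded_linear_of_complex] integrable_mult_right int)
    also have "(LINT z|lebesgue. ?k * ?G g0 z) = ?k * (LINT z|lebesgue. ?G g0 z)"
      by simp
    also have "(LINT z|lebesgue. ?G g0 z) = (LINT z|lebesgue. ?G g z)"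
    proof (rule integral_cong_AE)
      show "?G g0 \<in> borel_measurable lebesgue"
        using int by (rule borel_measurable_integrable)
      show "?G g \<in> borel_measurable lebesgue"
        by (rule measurable_completion) measurable
      show "AE z in lebesgue. ?G g0 z = ?G g z"
        using g' by eventually_elim simp
    qed
    also have "\<dots> = (LINT z|lborel. ?G g z)"
      by (rule integral_completion) measurable
    also have "\<dots> = fourier h (T w)"
      by (simp add: fourier_def h_def mult.assoc)
    finally show ?thesis .
  qed
  define k where "k = cmod c1 * cmod c2"
  \<comment> \<open>This constant cancels the 4 pi^2 from Plancherel's theorem together with the
    Jacobian of the frequency rescaling.\<close>
  have k: "k\<^sup>2 = 1 / (4 * pi\<^sup>2 * \<bar>b1 * b2\<bar>)"
    unfolding k_def power_mult_distrib c1_def c2_def norm_sq_inverse_csqrt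
    by (simp add: abs_mult power2_eq_square)
  then have "k \<noteq> 0"
    using b by auto
  have norm_qlct: "norm (qlct A1 A2 f w) = k * cmod (fourier h (T w))" for w
    by (simp add: qlct_eq norm_of_complex norm_mult k_def)
  \<comment> \<open>Here integrability of the canonical transform becomes integrability of
    \<open>fourier h\<close>, as required for inversion: the unimodular factors drop out of the
    norm, and \<open>k\<close> is nonzero.\<close>
  have "integrable lborel (\<lambda>w. k * cmod (fourier h (T w)))"
    using qf unfolding norm_qlct by (subst (asm) integrable_completion) auto
  then have "integrable lborel (\<lambda>w. fourier h (T w))"
    using \<open>k \<noteq> 0\<close> by (simp add: integrable_norm_iff)
  then have fh: "integrable lborel (fourier h)"
    unfolding T_eq by (subst integrable_lborel_prod_affine_iff[OF _ b', where t = 0]) auto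

  have "(LINT w|lebesgue. (norm (qlct A1 A2 f w))\<^sup>2) = (LINT w|lborel. (k * cmod (fourier h (T w)))\<^sup>2)"
    unfolding norm_qlct by (rule integral_completion) measurable
  also have "\<dots> = k\<^sup>2 * (LINT w|lborel. (cmod (fourier h (T w)))\<^sup>2)"
    by (simp add: power_mult_distrib)
  also have "(LINT w|lborel. (cmod (fourier h (T w)))\<^sup>2) = \<bar>b1 * b2\<bar> * (LINT w|lborel. (cmod (fourier h w))\<^sup>2)"
    using b by (subst (2) integral_lborel_prod_affine[OF _ b', where t = 0])
      (auto simp: T_def abs_mult field_simps)
  also have "(LINT w|lborel. (cmod (fourier h w))\<^sup>2) = 4 * pi\<^sup>2 * (LINT x|lborel. (cmod (h x))\<^sup>2)"
    by (rule plancherel[OF h fh])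
  also have "k\<^sup>2 * (\<bar>b1 * b2\<bar> * (4 * pi\<^sup>2 * (LINT x|lborel. (cmod (h x))\<^sup>2))) =
      (LINT x|lborel. (cmod (g x))\<^sup>2)"
    using b by (simp add: k norm_h)
  also have "\<dots> = (LINT x|lebesgue. (cmod (g x))\<^sup>2)"
    by (rule integral_completion[symmetric]) measurable
  also have "\<dots> = (LINT x|lebesgue. (norm (f x))\<^sup>2)"
  proof (rule integral_cong_AE)
    show "AE x in lebesgue. (cmod (g x))\<^sup>2 = (norm (f x))\<^sup>2"
      using g' by eventually_elim (simp add: f_g0 norm_of_complex)
    show "(\<lambda>x. (norm (f x))\<^sup>2) \<in> borel_measurable lebesgue"
      using f(1) by measurable
    show "(\<lambda>x. (cmod (g x))\<^sup>2) \<in> borel_measurable lebesgue"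
      by (rule measurable_completion) measurable
  qed
  finally show ?thesis
    by (rule sym)
qed

end
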